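(* Let $z = (z_0, z_1) \in \mathbb{R} \times \mathbb{R}^{n-1}$ and let $\overline{z}, \underline{z} \in \mathbb{R}$ satisfy $\underline{z} \leq \overline{z}$. Let $\mathcal{K}_{-} = \mathcal{K}_{-}(\overline{z})$, $\mathcal{K}_{+} = \mathcal{K}_{+}(\underline{z})$ and $\mathcal{D} = \mathcal{D}(\overline{z}, \underline{z}) = \mathcal{K}_{-}(\overline{z}) \cap \mathcal{K}_{+}(\underline{z}) \subset \mathbb{R}^n$. Then the Euclidean projection of $z$ onto $\mathcal{D}$ is given by $$\mathcal{P}_{\mathcal{D}}(z) = \mathcal{P}_{\mathcal{K}_{-}} \left( \mathcal{P}_{\mathcal{K}_{+}}(z) \right).$$
   Context: $\|\cdot\|$ denotes the standard Euclidean norm. $\mathbb{R}^n$ is identified with $\mathbb{R} \times \mathbb{R}^{n-1}$, and vectors are written $y = (y_0, y_1)$ with $y_0 \in \mathbb{R}$ and $y_1 \in \mathbb{R}^{n-1}$. For $c \in \mathbb{R}$, $\mathcal{K}_{+}(c) = \{ (y_0, y_1) \in \mathbb{R} \times \mathbb{R}^{n-1} : \|y_1\| \leq y_0 - c \}$ and $\mathcal{K}_{-}(c) = \{ (y_0, y_1) \in \mathbb{R} \times \mathbb{R}^{n-1} : \|y_1\| \leq -(y_0 - c) \}$. The Euclidean projection of $x \in \mathbb{R}^n$ onto a set $\mathcal{X} \subseteq \mathbb{R}^n$ is $\mathcal{P}_{\mathcal{X}}(x) = \arg\min_{v \in \mathcal{X}} \|v - x\|^2$. *)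

theory Defs
  imports "HOL-Analysis.Analysis"
begin

(*
  R^n = R \<times> R^(n-1) is rendered as real \<times> 'a, whose product norm is the Euclidean one.
  For the factor R^(n-1) we take 'a :: {real_inner, heine_borel}: a real inner product space
  with the Heine-Borel property, that is, one of finite dimension.  Unlike euclidean_space,
  this sort does not exclude dimension 0, so that n = 1 is covered.
*)

definition cone_plus :: "real \<Rightarrow> (real \<times> 'a::{real_inner,heine_borel}) set"  ("\<K>\<^sub>+") where
  "\<K>\<^sub>+ c = {(y0, y1). norm y1 \<le> y0 - c}"

definition cone_minus :: "real \<Rightarrow> (real \<times> 'a::{real_inner,heine_borel}) set"  ("\<K>\<^sub>-") where
  "\<K>\<^sub>- c = {(y0, y1). norm y1 \<le> - (y0 - c)}"

definition double_cone :: "real \<Rightarrow> real \<Rightarrow> (real \<times> 'a::{real_inner,heine_borel}) set"  ("\<D>") where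
  "\<D> zu zl = \<K>\<^sub>- zu \<inter> \<K>\<^sub>+ zl"

(*
  arg_min_on is a choice among the minimisers; eucl_proj_unique and the lemmas on the cones
  show that in all uses of interest there is exactly one.
*)

definition eucl_proj :: "'b::{real_inner,heine_borel} set \<Rightarrow> 'b \<Rightarrow> 'b"  ("\<P>") where
  "\<P> X x = arg_min_on (\<lambda>v. (norm (v - x))\<^sup>2) X"

lemma is_arg_min_sq_norm_iff:
  fixes x :: "'b::real_inner"
  shows "is_arg_min (\<lambda>v. (norm (v - x))\<^sup>2) (\<lambda>v. v \<in> X) v \<longleftrightarrow> v \<in> X \<and> (\<forall>y\<in>X. dist x v \<le> dist x y)"
  by (auto simp: is_arg_min_linorder dist_norm norm_minus_commute power_mono_iff)

lemma eucl_proj_eq_closest_point: "\<P> X x = closest_point X x"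
  by (simp add: eucl_proj_def arg_min_on_def arg_min_def closest_point_def is_arg_min_sq_norm_iff)

lemma eucl_proj_unique:
  assumes "closed X" "convex X" "X \<noteq> {}"
  shows "is_arg_min (\<lambda>v. (norm (v - x))\<^sup>2) (\<lambda>v. v \<in> X) v \<longleftrightarrow> v = \<P> X x"
  using closest_point_exists[OF assms(1,3), of x] closest_point_unique[OF assms(2,1), of v x]
  by (auto simp: is_arg_min_sq_norm_iff eucl_proj_eq_closest_point)

lemma closed_cone_plus: "closed (\<K>\<^sub>+ c)"
  and closed_cone_minus: "closed (\<K>\<^sub>- c)"
  by (auto simp: cone_plus_def cone_minus_def case_prod_unfold intro!: closed_Collect_le continuous_intros)

lemma convex_cone_aux: "convex {y :: real \<times> 'a::real_inner. norm (snd y) \<le> s * (fst y - c)}"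
proof (rule convexI, clarsimp)
  fix x0 y0 u v :: real and x1 y1 :: 'a
  assume x: "norm x1 \<le> s * (x0 - c)" and y: "norm y1 \<le> s * (y0 - c)"
    and uv: "0 \<le> u" "0 \<le> v" "u + v = 1"
  have "norm (u *\<^sub>R x1 + v *\<^sub>R y1) \<le> u * norm x1 + v * norm y1"
    using norm_triangle_ineq[of "u *\<^sub>R x1" "v *\<^sub>R y1"] uv by simp
  also have "\<dots> \<le> u * (s * (x0 - c)) + v * (s * (y0 - c))"
    using x y uv by (intro add_mono mult_left_mono)
  also have "\<dots> = s * (u * x0 + v * y0 - (u + v) * c)"
    by (simp add: algebra_simps)
  finally show "norm (u *\<^sub>R x1 + v *\<^sub>R y1) \<le> s * (u * x0 + v * y0 - c)"
    using uv by simp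
qed

lemma convex_cone_plus: "convex (\<K>\<^sub>+ c)"
  using convex_cone_aux[of 1 c] by (simp add: cone_plus_def case_prod_unfold)

lemma convex_cone_minus: "convex (\<K>\<^sub>- c)"
  using convex_cone_aux[of "-1" c] by (simp add: cone_minus_def case_prod_unfold)

lemma closed_double_cone: "closed (\<D> zu zl)"
  and convex_double_cone: "convex (\<D> zu zl)"
  by (simp_all add: double_cone_def closed_Int convex_Int closed_cone_plus closed_cone_minus
      convex_cone_plus convex_cone_minus)

lemma cone_plus_nonempty: "\<K>\<^sub>+ c \<noteq> {}"
proof -
  have "(c, 0) \<in> \<K>\<^sub>+ c" by (simp add: cone_plus_def)
  then show ?thesis by blast
qed

lemma cone_minus_nonempty: "\<K>\<^sub>- c \<noteq> {}"
proof -
  have "(c, 0) \<in> \<K>\<^sub>- c" by (simp add: cone_minus_def)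
  then show ?thesis by blast
qed

lemma double_cone_nonempty:
  assumes "zl \<le> zu"
  shows "\<D> zu zl \<noteq> {}"
proof -
  have "(zl, 0) \<in> \<D> zu zl"
    using assms by (simp add: double_cone_def cone_plus_def cone_minus_def)
  then show ?thesis by blast
qed

end

(*
  Write p for the projection of z onto K+ and q for that of p onto K-.  The explicit formula
  for the projection onto a right-angled cone shows that q lies in K+, and that, unless z = p,
  the point p is on the boundary of K+ and q is on the ray from the apex a of K+ through p.
  Since z - p is orthogonal to p - a, it is then orthogonal to q - p.  So for y in the
  intersection, <z - q, y - q> = <z - p, y - p> + <p - q, y - q> \<le> 0 by the variational
  inequalities for p and q, and this inequality characterises q as the projection of z.
*)

theory Submission
  imports Defs
begin

lemma eucl_proj_dot:
  assumes "closed X" "convex X" "y \<in> X"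
  shows "(x - \<P> X x) \<bullet> (y - \<P> X x) \<le> 0"
  using closest_point_dot[OF assms(2,1,3)] by (simp add: eucl_proj_eq_closest_point)

lemma eucl_proj_in:
  assumes "closed X" "X \<noteq> {}"
  shows "\<P> X x \<in> X"
  using closest_point_in_set[OF assms] by (simp add: eucl_proj_eq_closest_point)

text \<open>Converse of \<open>eucl_proj_dot\<close>. Expanding the squared norm of (x - v) - (y -
  v), the hypothesis on the cross term makes v a closest point; convexity and closedness make it the
  only one.\<close>

lemma eucl_proj_eqI:
  assumes "closed X" "convex X" "v \<in> X" and dot: "\<And>y. y \<in> X \<Longrightarrow> (x - v) \<bullet> (y - v) \<le> 0"
  shows "\<P> X x = v"
proof -
  have "dist x v \<le> dist x y" if "y \<in> X" for y
  proof -
    have "(norm (x - y))\<^sup>2 = (norm (x - v))\<^sup>2 - 2 * ((x - v) \<bullet> (y - v)) + (norm (y - v))\<^sup>2"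
      by (simp add: power2_norm_eq_inner inner_diff inner_commute algebra_simps)
    also have "\<dots> \<ge> (norm (x - v))\<^sup>2"
      using dot[OF that] zero_le_power2[of "norm (y - v)"] by linarith
    finally show ?thesis
      by (simp add: dist_norm)
  qed
  then show ?thesis
    using closest_point_unique[OF assms(2,1,3)] by (simp add: eucl_proj_eq_closest_point)
qed

lemma eucl_proj_self: "x \<in> X \<Longrightarrow> \<P> X x = x"
  by (simp add: eucl_proj_eq_closest_point closest_point_self)

text \<open>Taking the sign \<open>s\<close> to be \<open>1\<close> or \<open>-1\<close> gives \<open>\<K>\<^sub>+ c\<close> or \<open>\<K>\<^sub>- c\<close>.\<close>

lemma eucl_proj_cone:
  fixes w1 :: "'a::{real_inner,heine_borel}" and s c w0 :: real
  defines "K \<equiv> {y. norm (snd y) \<le> s * (fst y - c)}" and "t \<equiv> (norm w1 + s * (w0 - c)) / 2"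
  assumes s: "s * s = 1"
  shows eucl_proj_cone_polar: "norm w1 \<le> - (s * (w0 - c)) \<Longrightarrow> \<P> K (w0, w1) = (c, 0)"
    and eucl_proj_cone_side: "\<bar>w0 - c\<bar> < norm w1 \<Longrightarrow>
      \<P> K (w0, w1) = (c + s * t, (t / norm w1) *\<^sub>R w1)"
proof -
  have K: "convex K" "closed K"
    unfolding K_def by (simp_all add: convex_cone_aux closed_Collect_le continuous_intros)
  have s_abs: "s * (w0 - c) \<le> \<bar>w0 - c\<bar>" "- (s * (w0 - c)) \<le> \<bar>w0 - c\<bar>"
    using s by (metis abs_mult abs_one abs_mult_self_eq abs_ge_self abs_ge_minus_self
        mult.right_neutral mult.left_neutral real_sqrt_abs2 real_sqrt_one)+
  have cs: "w1 \<bullet> y \<le> norm w1 * norm y" for y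
    by (rule norm_cauchy_schwarz)
  show "\<P> K (w0, w1) = (c, 0)" if w: "norm w1 \<le> - (s * (w0 - c))"
  proof (rule eucl_proj_eqI[OF K(2,1)])
    fix y assume y: "y \<in> K"
    \<comment> \<open>Multiplying the two cone inequalities gives the bound -(w0 - c) * (fst y - c),
      as s * s = 1. By Cauchy-Schwarz this is the variational inequality at the apex.\<close>
    have "norm w1 * norm (snd y) \<le> - (s * (w0 - c)) * (s * (fst y - c))"
      using y w order_trans[OF norm_ge_zero w] by (intro mult_mono) (auto simp: K_def)
    also have "\<dots> = - ((s * s) * ((w0 - c) * (fst y - c)))"
      by (simp add: algebra_simps)
    finally show "((w0, w1) - (c, 0)) \<bullet> (y - (c, 0)) \<le> 0"
      using cs[of "snd y"] s by (cases y) simp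
  qed (simp add: K_def)
  show "\<P> K (w0, w1) = (c + s * t, (t / norm w1) *\<^sub>R w1)" if w: "\<bar>w0 - c\<bar> < norm w1"
  proof (rule eucl_proj_eqI[OF K(2,1)])
    have n: "norm w1 > 0" using w by linarith
    have t: "t > 0" using w s_abs by (simp add: t_def)
    show "(c + s * t, (t / norm w1) *\<^sub>R w1) \<in> K"
      using n t s by (simp add: K_def flip: mult.assoc)
    fix y assume y: "y \<in> K"
    \<comment> \<open>In the orthonormal frame (s, w1/|w1|)/sqrt 2, (-s, w1/|w1|)/sqrt 2, a
      generator of the cone and its outward normal, the point minus the apex has coordinates t and d
      up to the factor sqrt 2. The projection keeps t and drops d, so the residual is d * (-s,
      w1/|w1|).\<close>
    define d where "d = norm w1 - t"
    have d: "d > 0" using w s_abs by (simp add: d_def t_def)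
    have "s * (s * (w0 - c)) = w0 - c"
      using s by (simp flip: mult.assoc)
    moreover have "s * (w0 - c) = t - d" by (simp add: d_def t_def field_simps)
    ultimately have "w0 - c = s * (t - d)" by simp
    then have e: "w0 - (c + s * t) = - (s * d)" by (simp add: algebra_simps)
    have f: "w1 - (t / norm w1) *\<^sub>R w1 = (d / norm w1) *\<^sub>R w1"
      using n by (simp add: d_def diff_divide_distrib scaleR_diff_left)
    have "((w0, w1) - (c + s * t, (t / norm w1) *\<^sub>R w1)) \<bullet> (y - (c + s * t, (t / norm w1) *\<^sub>R w1))
      = - (s * d) * (fst y - c - s * t) + (d / norm w1) * (w1 \<bullet> snd y - t / norm w1 * (norm w1)\<^sup>2)"
      by (cases y) (simp add: e f inner_diff_right power2_norm_eq_inner algebra_simps)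
    also have "\<dots> = (s * s) * d * t - d * (s * (fst y - c)) + (d / norm w1) * (w1 \<bullet> snd y) - d * t"
      using n by (simp add: field_simps power2_eq_square)
    also have "\<dots> = d * ((w1 \<bullet> snd y) / norm w1 - s * (fst y - c))"
      unfolding s by (simp add: algebra_simps)
    also have "\<dots> \<le> 0"
    proof -
      have "(w1 \<bullet> snd y) / norm w1 \<le> norm (snd y)"
        using cs[of "snd y"] n by (simp add: field_simps)
      with y d show ?thesis
        by (intro mult_nonneg_nonpos) (auto simp: K_def)
    qed
    finally show "((w0, w1) - (c + s * t, (t / norm w1) *\<^sub>R w1)) \<bullet>
      (y - (c + s * t, (t / norm w1) *\<^sub>R w1)) \<le> 0" .
  qed
qed

lemma cone_plus_eq: "\<K>\<^sub>+ c = {y. norm (snd y) \<le> 1 * (fst y - c)}"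
  and cone_minus_eq: "\<K>\<^sub>- c = {y. norm (snd y) \<le> (-1) * (fst y - c)}"
  by (auto simp: cone_plus_def cone_minus_def)

text \<open>A point outside the cone projects either to the apex, where u = 0, or to the lateral
  surface, where u is a positive multiple of z1.\<close>

lemma eucl_proj_cone_plus_boundary:
  assumes "(z0, z1) \<notin> \<K>\<^sub>+ c"
  obtains u where "\<P> (\<K>\<^sub>+ c) (z0, z1) = (c + norm u, u)"
proof (cases "norm z1 \<le> c - z0")
  case True
  then show ?thesis
    using that[of 0] eucl_proj_cone_polar[of 1 z1 z0 c] by (simp add: cone_plus_eq)
next
  case False
  with assms have "\<bar>z0 - c\<bar> < norm z1"
    by (auto simp: cone_plus_eq)
  moreover define t where "t = (norm z1 + (z0 - c)) / 2"
  ultimately have "norm z1 > 0" "t > 0"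
    by (auto simp: t_def)
  then have "norm ((t / norm z1) *\<^sub>R z1) = t"
    by simp
  with \<open>\<bar>z0 - c\<bar> < norm z1\<close> show ?thesis
    using that[of "(t / norm z1) *\<^sub>R z1"]
      eucl_proj_cone_side[of 1 z0 c z1] by (simp add: cone_plus_eq t_def)
qed

lemma eucl_proj_cone_minus_in_cone_plus:
  assumes "zl \<le> zu" "(w0, w1) \<in> \<K>\<^sub>+ zl"
  shows "\<P> (\<K>\<^sub>- zu) (w0, w1) \<in> \<K>\<^sub>+ zl"
proof -
  consider "(w0, w1) \<in> \<K>\<^sub>- zu" | "norm w1 \<le> w0 - zu" | "\<bar>w0 - zu\<bar> < norm w1"
    by (force simp: cone_minus_def)
  then show ?thesis
  proof cases
    case 1
    then show ?thesis using assms by (simp add: eucl_proj_self)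
  next
    case 2
    then show ?thesis
      using assms eucl_proj_cone_polar[of "-1" w1 w0 zu] by (simp add: cone_plus_def cone_minus_eq)
  next
    case 3
    \<comment> \<open>The projection has height zu - t and radius t, so it lies in the upward cone
      iff 2 * t \<le> zu - zl. This is exactly the membership of (w0, w1), since 2 * t = |w1| - w0 +
      zu.\<close>
    define t where "t = (norm w1 - (w0 - zu)) / 2"
    have "norm w1 > 0" "t > 0" "2 * t \<le> zu - zl"
      using 3 assms(2) by (auto simp: t_def cone_plus_def)
    then have "(zu - t, (t / norm w1) *\<^sub>R w1) \<in> \<K>\<^sub>+ zl"
      by (simp add: cone_plus_def)
    moreover have "\<P> (\<K>\<^sub>- zu) (w0, w1) = (zu - t, (t / norm w1) *\<^sub>R w1)"
      using eucl_proj_cone_side[of "-1" w0 zu w1] 3 by (simp add: cone_minus_eq t_def field_simps)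
    ultimately show ?thesis
      by simp
  qed
qed

text \<open>Generators of the two cones over the same direction u are perpendicular, so projecting a
  point of one onto the other moves it along its own ray.\<close>

lemma eucl_proj_cone_minus_on_ray:
  assumes "zl \<le> zu"
  obtains l where "\<P> (\<K>\<^sub>- zu) (zl + norm u, u) = (zl, 0) + l *\<^sub>R (norm u, u)"
proof -
  \<comment> \<open>The polar case |u| \<le> zl + |u| - zu forces zl = zu, and then both apexes
    coincide.\<close>
  consider "(zl + norm u, u) \<in> \<K>\<^sub>- zu" | "zl = zu" | "\<bar>zl + norm u - zu\<bar> < norm u"
    using assms by (force simp: cone_minus_def)
  then show ?thesis
  proof cases
    case 1
    then show ?thesis using that[of 1] by (simp add: eucl_proj_self)
  next
    case 2
    then show ?thesis
      using that[of 0] eucl_proj_cone_polar[of "-1" u "zl + norm u" zu] by (simp add: cone_minus_eq)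
  next
    case 3
    then have "norm u \<noteq> 0" by linarith
    with 3 show ?thesis
      \<comment> \<open>The radius (|u| - (zl + |u| - zu)) / 2 of the projection is (zu - zl) / 2
        for every u.\<close>
      using that[of "(zu - zl) / 2 / norm u"] eucl_proj_cone_side[of "-1" "zl + norm u" zu u]
      by (simp add: cone_minus_eq field_simps)
  qed
qed

theorem theorem2:
  fixes z0 :: real and z1 :: "'a::{real_inner,heine_borel}" and zu zl :: real
  assumes "zl \<le> zu"
  shows "\<P> (\<D> zu zl) (z0, z1) = \<P> (\<K>\<^sub>- zu) (\<P> (\<K>\<^sub>+ zl) (z0, z1))"
proof -
  define z where "z = (z0, z1)"
  define p where "p = \<P> (\<K>\<^sub>+ zl) z"
  define q where "q = \<P> (\<K>\<^sub>- zu) p"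
  have p_in: "p \<in> \<K>\<^sub>+ zl"
    unfolding p_def by (rule eucl_proj_in[OF closed_cone_plus cone_plus_nonempty])
  have p_dot: "(z - p) \<bullet> (y - p) \<le> 0" if "y \<in> \<K>\<^sub>+ zl" for y
    using eucl_proj_dot[OF closed_cone_plus convex_cone_plus that] by (simp add: p_def)
  have q_dot: "(p - q) \<bullet> (y - q) \<le> 0" if "y \<in> \<K>\<^sub>- zu" for y
    using eucl_proj_dot[OF closed_cone_minus convex_cone_minus that] by (simp add: q_def)
  have "q \<in> \<K>\<^sub>- zu"
    unfolding q_def by (rule eucl_proj_in[OF closed_cone_minus cone_minus_nonempty])
  moreover have "q \<in> \<K>\<^sub>+ zl"
    using eucl_proj_cone_minus_in_cone_plus[OF assms] p_in unfolding q_def by (cases p) simp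
  ultimately have q_in: "q \<in> \<D> zu zl"
    by (simp add: double_cone_def)
  have orth: "(z - p) \<bullet> (q - p) = 0"
  proof (cases "z \<in> \<K>\<^sub>+ zl")
    case True
    then show ?thesis by (simp add: p_def eucl_proj_self)
  next
    case False
    then obtain u where p: "p = (zl + norm u, u)"
      using eucl_proj_cone_plus_boundary unfolding z_def p_def by metis
    obtain l where l: "q = (zl, 0) + l *\<^sub>R (norm u, u)"
      using eucl_proj_cone_minus_on_ray[OF assms] unfolding q_def p by metis
    \<comment> \<open>The apex and its reflection through \<open>p\<close> both lie in the cone, on
      opposite sides of \<open>p\<close>. Testing \<open>p_dot\<close> with each gives both signs,
      hence orthogonality to the ray.\<close>
    have "(z - p) \<bullet> ((zl, 0) - p) \<le> 0"
      by (rule p_dot) (simp add: cone_plus_def)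
    moreover have "(z - p) \<bullet> ((zl + 2 * norm u, 2 *\<^sub>R u) - p) \<le> 0"
      by (rule p_dot) (simp add: cone_plus_def)
    moreover have "(zl, 0) - p = - (norm u, u)" "(zl + 2 * norm u, 2 *\<^sub>R u) - p = (norm u, u)"
      by (simp_all add: p scaleR_2)
    ultimately have "(z - p) \<bullet> (norm u, u) = 0"
      by (simp only: inner_minus_right)
    moreover have "q - p = (l - 1) *\<^sub>R (norm u, u)"
      by (simp add: p l algebra_simps)
    ultimately show ?thesis
      by (simp only: inner_scaleR_right)
  qed
  have "\<P> (\<D> zu zl) z = q"
  proof (rule eucl_proj_eqI[OF closed_double_cone convex_double_cone q_in])
    fix y :: "real \<times> 'a" assume "y \<in> \<D> zu zl"
    then have "(z - p) \<bullet> (y - p) \<le> 0" "(p - q) \<bullet> (y - q) \<le> 0"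
      by (auto simp: double_cone_def intro: p_dot q_dot)
    moreover have "(z - q) \<bullet> (y - q) = (z - p) \<bullet> (y - p) - (z - p) \<bullet> (q - p) + (p - q) \<bullet> (y - q)"
      by (simp add: inner_diff_left inner_diff_right algebra_simps)
    ultimately show "(z - q) \<bullet> (y - q) \<le> 0"
      using orth by linarith
  qed
  then show ?thesis
    by (simp add: z_def p_def q_def)
qed

end
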